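(* Let $A\in\mathbb{H}^{n\times n}$ be a normal matrix, i.e. $AA^*=A^*A$, and let $q\in\mathbb{H}$ be a right eigenvalue of $A$. Then $$a.m.(q,A)=g.m.(q,A).$$
   Context: $\mathbb{H}$ is the algebra of real quaternions with units $i,j,k$, and $\mathbb{C}=\{a+bi: a,b\in\mathbb{R}\}\subset\mathbb{H}$. Two quaternions $q_1,q_2$ are similar if $q_1=h^{-1}q_2h$ for some nonzero $h\in\mathbb{H}$; $[q]$ denotes the similarity class of $q$. It is known that each class $[q]$ contains a unique complex number $\lambda_q$ with $\mathrm{Im}(\lambda_q)\ge0$. $\mathbb{H}^n$ is the space of column vectors of length $n$ with entries in $\mathbb{H}$, regarded as a right $\mathbb{H}$-vector space. A quaternion $q$ is a right eigenvalue of $A\in\mathbb{H}^{n\times n}$ if there is a nonzero $x\in\mathbb{H}^n$ with $Ax=xq$. $A^*$ is the conjugate transpose; $U$ is unitary if $U^*U=UU^*=Id$. Algebraic multiplicity: it is known that there are $U,T\in\mathbb{H}^{n\times n}$ with $U$ unitary, $T$ upper triangular, $T=U^*AU$, and all diagonal entries of $T$ complex numbers with nonnegative imaginary part. For a right eigenvalue $q$ of $A$, $a.m.(q,A)$ is the number of occurrences of $\lambda_q$ on the diagonal of such a $T$ (this number does not depend on the choice of $U,T$). Geometric multiplicity: for $\tilde q\in\mathbb{H}$ put $V_{\tilde q}=\{x\in\mathbb{H}^n: Ax=x\tilde q\}$. The $[q]$-eigenspace is $V_{[q]}:=\sum_{\tilde q\in[q]}V_{\tilde q}$, the set of all finite sums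 of vectors each lying in some $V_{\tilde q}$ with $\tilde q\in[q]$; it is a right $\mathbb{H}$-vector subspace of $\mathbb{H}^n$. Then $g.m.(q,A):=\dim_{\mathbb{H}}V_{[q]}$, the dimension as a right $\mathbb{H}$-vector space. *)

theory Defs
  imports Complex_Main "Jordan_Normal_Form.Matrix" "Jordan_Normal_Form.Conjugate"
begin

section \<open>Quaternions\<close>

text \<open>\<^term>\<open>Quat a b c d\<close> is the quaternion $a + bi + cj + dk$.\<close>

datatype quat = Quat (qRe: real) (qI: real) (qJ: real) (qK: real)

lemma quat_eq_iff: "p = q \<longleftrightarrow> qRe p = qRe q \<and> qI p = qI q \<and> qJ p = qJ q \<and> qK p = qK q"
  by (cases p; cases q) simp

instantiation quat :: division_ring
begin

definition zero_quat :: quat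
  where "0 = Quat 0 0 0 0"

definition one_quat :: quat
  where "1 = Quat 1 0 0 0"

definition plus_quat :: "quat \<Rightarrow> quat \<Rightarrow> quat"
  where "p + q = Quat (qRe p + qRe q) (qI p + qI q) (qJ p + qJ q) (qK p + qK q)"

definition uminus_quat :: "quat \<Rightarrow> quat"
  where "- q = Quat (- qRe q) (- qI q) (- qJ q) (- qK q)"

definition minus_quat :: "quat \<Rightarrow> quat \<Rightarrow> quat"
  where "p - q = Quat (qRe p - qRe q) (qI p - qI q) (qJ p - qJ q) (qK p - qK q)"

definition times_quat :: "quat \<Rightarrow> quat \<Rightarrow> quat"
  where "p * q = Quat
    (qRe p * qRe q - qI p * qI q - qJ p * qJ q - qK p * qK q)
    (qRe p * qI q + qI p * qRe q + qJ p * qK q - qK p * qJ q)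
    (qRe p * qJ q - qI p * qK q + qJ p * qRe q + qK p * qI q)
    (qRe p * qK q + qI p * qJ q - qJ p * qI q + qK p * qRe q)"

definition inverse_quat :: "quat \<Rightarrow> quat"
  where "inverse q = (let N = (qRe q)\<^sup>2 + (qI q)\<^sup>2 + (qJ q)\<^sup>2 + (qK q)\<^sup>2
    in Quat (qRe q / N) (- qI q / N) (- qJ q / N) (- qK q / N))"

definition divide_quat :: "quat \<Rightarrow> quat \<Rightarrow> quat"
  where "p div q = p * inverse (q :: quat)"

lemma quat_norm_sq_nonzero:
  assumes "q \<noteq> 0"
  shows "(qRe q)\<^sup>2 + (qI q)\<^sup>2 + (qJ q)\<^sup>2 + (qK q)\<^sup>2 \<noteq> 0"
proof
  assume "(qRe q)\<^sup>2 + (qI q)\<^sup>2 + (qJ q)\<^sup>2 + (qK q)\<^sup>2 = 0"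
  then have "qRe q = 0 \<and> qI q = 0 \<and> qJ q = 0 \<and> qK q = 0"
    by (smt (verit) zero_le_power2 power2_eq_iff power_zero_numeral)
  with assms show False
    by (simp add: quat_eq_iff zero_quat_def)
qed

instance
proof
  fix p q r :: quat
  show "p * q * r = p * (q * r)"
    by (simp add: quat_eq_iff times_quat_def algebra_simps)
  show "(p + q) * r = p * r + q * r" "p * (q + r) = p * q + p * r"
    by (simp_all add: quat_eq_iff times_quat_def plus_quat_def algebra_simps)
  show "p div q = p * inverse q"
    by (rule divide_quat_def)
  show "inverse (0 :: quat) = 0"
    by (simp add: inverse_quat_def zero_quat_def)
  {
    assume "q \<noteq> 0"
    define m where "m = inverse ((qRe q)\<^sup>2 + (qI q)\<^sup>2 + (qJ q)\<^sup>2 + (qK q)\<^sup>2)"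
    have inv: "inverse q = Quat (qRe q * m) (- qI q * m) (- qJ q * m) (- qK q * m)"
      by (simp add: inverse_quat_def Let_def m_def divide_inverse)
    have "m * ((qRe q)\<^sup>2 + (qI q)\<^sup>2 + (qJ q)\<^sup>2 + (qK q)\<^sup>2) = 1"
      unfolding m_def by (rule left_inverse[OF quat_norm_sq_nonzero[OF \<open>q \<noteq> 0\<close>]])
    then show "inverse q * q = 1" "q * inverse q = 1"
      unfolding inv by (simp_all add: quat_eq_iff times_quat_def one_quat_def
          power2_eq_square algebra_simps)
  }
qed (simp_all add: quat_eq_iff times_quat_def plus_quat_def uminus_quat_def minus_quat_def
    zero_quat_def one_quat_def)

end

text \<open>
  Only the class \<^class>\<open>conjugate\<close> is instantiated: quaternionic conjugation reverses products,
  so \<^class>\<open>conjugatable_ring\<close> does not apply.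
\<close>

instantiation quat :: conjugate
begin

definition conjugate_quat :: "quat \<Rightarrow> quat"
  where "conjugate q = Quat (qRe q) (- qI q) (- qJ q) (- qK q)"

instance
  by standard (auto simp: conjugate_quat_def quat_eq_iff)

end

definition similar_quat :: "quat \<Rightarrow> quat \<Rightarrow> bool"
  where "similar_quat p q \<longleftrightarrow> (\<exists>h. h \<noteq> 0 \<and> p = inverse h * q * h)"

definition upper_complex :: "quat set"
  where "upper_complex = {Quat a b 0 0 | a b. b \<ge> 0}"

definition class_rep :: "quat \<Rightarrow> quat"
  where "class_rep q = (THE z. z \<in> upper_complex \<and> similar_quat z q)"


section \<open>Quaternionic vectors as a right vector space\<close>

text \<open>The library operation \<^const>\<open>smult_vec\<close> multiplies by scalars from the left.\<close>

definition rsmult_vec :: "quat vec \<Rightarrow> quat \<Rightarrow> quat vec"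
  where "rsmult_vec x q = map_vec (\<lambda>a. a * q) x"

definition sum_list_vec :: "nat \<Rightarrow> quat vec list \<Rightarrow> quat vec"
  where "sum_list_vec n xs = foldr (+) xs (0\<^sub>v n)"

definition right_lincomb :: "nat \<Rightarrow> quat vec list \<Rightarrow> (nat \<Rightarrow> quat) \<Rightarrow> quat vec"
  where "right_lincomb n bs c = sum_list_vec n (map (\<lambda>k. rsmult_vec (bs ! k) (c k)) [0..<length bs])"

definition right_basis :: "nat \<Rightarrow> quat vec set \<Rightarrow> quat vec list \<Rightarrow> bool"
  where "right_basis n V bs \<longleftrightarrow>
    set bs \<subseteq> V \<and>
    (\<forall>x\<in>V. \<exists>c. x = right_lincomb n bs c) \<and>
    (\<forall>c. right_lincomb n bs c = 0\<^sub>v n \<longrightarrow> (\<forall>k<length bs. c k = 0))"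

text \<open>Intended for right subspaces $V$ of the quaternionic column vectors of length $n$.\<close>

definition right_dim :: "nat \<Rightarrow> quat vec set \<Rightarrow> nat"
  where "right_dim n V = (THE d. \<exists>bs. right_basis n V bs \<and> length bs = d)"


section \<open>Right eigenvalues and their multiplicities\<close>

text \<open>The operation mat_adjoint of theory Schur_Decomposition requires entries from a field.\<close>

definition conj_transpose :: "quat mat \<Rightarrow> quat mat"
  where "conj_transpose A = map_mat conjugate (transpose_mat A)"

definition normal_mat :: "quat mat \<Rightarrow> bool"
  where "normal_mat A \<longleftrightarrow> A * conj_transpose A = conj_transpose A * A"

definition unitary_mat :: "nat \<Rightarrow> quat mat \<Rightarrow> bool"
  where "unitary_mat n U \<longleftrightarrow> U \<in> carrier_mat n n \<and>
    conj_transpose U * U = 1\<^sub>m n \<and> U * conj_transpose U = 1\<^sub>m n"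

definition right_eigenvalue :: "quat mat \<Rightarrow> quat \<Rightarrow> bool"
  where "right_eigenvalue A q \<longleftrightarrow>
    (\<exists>x \<in> carrier_vec (dim_row A). x \<noteq> 0\<^sub>v (dim_row A) \<and> A *\<^sub>v x = rsmult_vec x q)"

definition schur_form :: "quat mat \<Rightarrow> quat mat \<Rightarrow> quat mat \<Rightarrow> bool"
  where "schur_form A U T \<longleftrightarrow>
    unitary_mat (dim_row A) U \<and> T \<in> carrier_mat (dim_row A) (dim_row A) \<and> upper_triangular T \<and>
    T = conj_transpose U * A * U \<and> (\<forall>i<dim_row A. T $$ (i, i) \<in> upper_complex)"

definition alg_mult :: "quat \<Rightarrow> quat mat \<Rightarrow> nat"
  where "alg_mult q A = (THE m. \<exists>U T. schur_form A U T \<and>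
    m = card {i. i < dim_row A \<and> T $$ (i, i) = class_rep q})"

definition eigen_set :: "quat mat \<Rightarrow> quat \<Rightarrow> quat vec set"
  where "eigen_set A p = {x \<in> carrier_vec (dim_row A). A *\<^sub>v x = rsmult_vec x p}"

definition class_eigenspace :: "quat mat \<Rightarrow> quat \<Rightarrow> quat vec set"
  where "class_eigenspace A q =
    {sum_list_vec (dim_row A) xs | xs. \<forall>x\<in>set xs. \<exists>p. similar_quat p q \<and> x \<in> eigen_set A p}"

definition geom_mult :: "quat \<Rightarrow> quat mat \<Rightarrow> nat"
  where "geom_mult q A = right_dim (dim_row A) (class_eigenspace A q)"

end

(*
  Since the entries of a Schur form of A lie in upper_complex, the similarity class of q contributes
  exactly one diagonal value lambda. A Schur form T = U^* A U of a normal matrix is normal and upper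
  triangular, hence diagonal, so A x = x p with p similar to q forces the coordinates of U^* x at the
  indices i with T_ii different from lambda to vanish. The columns of U at the remaining indices
  therefore form a basis of the class eigenspace, and there are as many of them as occurrences of
  lambda. Invariance of the right dimension makes this count independent of the Schur form.

  A Schur form exists because left multiplication by A, seen as a complex linear map of twice the
  size, has an eigenvector, which is then split off by a Householder reflection.
*)

theory Submission
  imports Defs "Jordan_Normal_Form.Spectral_Radius"
begin

section \<open>Arithmetic and similarity of quaternions\<close>

definition quat_of_real :: "real \<Rightarrow> quat"
  where "quat_of_real r = Quat r 0 0 0"

definition quat_norm_sq :: "quat \<Rightarrow> real"
  where "quat_norm_sq q = (qRe q)\<^sup>2 + (qI q)\<^sup>2 + (qJ q)\<^sup>2 + (qK q)\<^sup>2"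

lemma quat_components [simp]:
  "qRe 0 = 0" "qI 0 = 0" "qJ 0 = 0" "qK 0 = 0"
  "qRe 1 = 1" "qI 1 = 0" "qJ 1 = 0" "qK 1 = 0"
  "qRe (p + q) = qRe p + qRe q" "qI (p + q) = qI p + qI q"
  "qJ (p + q) = qJ p + qJ q" "qK (p + q) = qK p + qK q"
  "qRe (p - q) = qRe p - qRe q" "qI (p - q) = qI p - qI q"
  "qJ (p - q) = qJ p - qJ q" "qK (p - q) = qK p - qK q"
  "qRe (- q) = - qRe q" "qI (- q) = - qI q" "qJ (- q) = - qJ q" "qK (- q) = - qK q"
  "qRe (conjugate q) = qRe q" "qI (conjugate q) = - qI q"
  "qJ (conjugate q) = - qJ q" "qK (conjugate q) = - qK q"
  "qRe (quat_of_real r) = r" "qI (quat_of_real r) = 0"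
  "qJ (quat_of_real r) = 0" "qK (quat_of_real r) = 0"
  by (simp_all add: zero_quat_def one_quat_def plus_quat_def minus_quat_def uminus_quat_def
      conjugate_quat_def quat_of_real_def)

lemma quat_times_components:
  "qRe (p * q) = qRe p * qRe q - qI p * qI q - qJ p * qJ q - qK p * qK q"
  "qI (p * q) = qRe p * qI q + qI p * qRe q + qJ p * qK q - qK p * qJ q"
  "qJ (p * q) = qRe p * qJ q - qI p * qK q + qJ p * qRe q + qK p * qI q"
  "qK (p * q) = qRe p * qK q + qI p * qJ q - qJ p * qI q + qK p * qRe q"
  by (simp_all add: times_quat_def)

lemmas quat_arith = quat_eq_iff quat_times_components algebra_simps

lemma quat_of_real_commute: "quat_of_real r * q = q * quat_of_real r"
  by (simp add: quat_arith)

lemma quat_of_real_arith [simp]: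
  "quat_of_real r * quat_of_real s = quat_of_real (r * s)"
  "quat_of_real r + quat_of_real s = quat_of_real (r + s)"
  "quat_of_real 0 = 0" "quat_of_real 1 = 1"
  "conjugate (quat_of_real r) = quat_of_real r"
  by (simp_all add: quat_arith)

lemma quat_of_real_sum: "quat_of_real (\<Sum>i\<in>S. f i) = (\<Sum>i\<in>S. quat_of_real (f i))"
  by (induction S rule: infinite_finite_induct) (simp_all flip: quat_of_real_arith(2))

lemma qRe_sum: "qRe (\<Sum>i\<in>S. f i) = (\<Sum>i\<in>S. qRe (f i))"
  by (induction S rule: infinite_finite_induct) simp_all

lemma quat_conjugate_simps [simp]:
  "conjugate (0 :: quat) = 0" "conjugate (1 :: quat) = 1"
  "conjugate (p + q) = conjugate p + conjugate (q :: quat)"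
  "conjugate (p - q) = conjugate p - conjugate (q :: quat)"
  "conjugate (p * q) = conjugate q * conjugate (p :: quat)"
  by (simp_all add: quat_arith)

lemma quat_conjugate_sum: "conjugate (\<Sum>i\<in>S. f i) = (\<Sum>i\<in>S. conjugate (f i :: quat))"
  by (induction S rule: infinite_finite_induct) simp_all

lemma quat_mult_conjugate:
  "q * conjugate q = quat_of_real (quat_norm_sq q)"
  "conjugate q * q = quat_of_real (quat_norm_sq q)"
  by (simp_all add: quat_arith quat_norm_sq_def power2_eq_square)

text \<open>This is Euler's four-square identity. It makes the norm an invariant of
  similarity.\<close>

lemma quat_norm_sq_mult: "quat_norm_sq (p * q) = quat_norm_sq p * quat_norm_sq q"
  by (simp add: quat_norm_sq_def quat_times_components power2_eq_square algebra_simps)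

lemma quat_norm_sq_nonneg [simp]: "0 \<le> quat_norm_sq q"
  by (simp add: quat_norm_sq_def)

lemma quat_norm_sq_eq_0_iff [simp]: "quat_norm_sq q = 0 \<longleftrightarrow> q = 0"
  using quat_norm_sq_nonzero by (auto simp: quat_norm_sq_def)

lemma quat_norm_sq_pos_iff [simp]: "0 < quat_norm_sq q \<longleftrightarrow> q \<noteq> 0"
  by (simp add: less_le)

lemma quat_norm_sq_simps [simp]:
  "quat_norm_sq 0 = 0" "quat_norm_sq 1 = 1" "quat_norm_sq (quat_of_real r) = r\<^sup>2" "quat_norm_sq (conjugate q) = quat_norm_sq q"
  by (simp_all add: quat_norm_sq_def)

section \<open>Similarity classes and their complex representatives\<close>

lemma qRe_conj_similar:
  assumes "h \<noteq> 0"
  shows "qRe (inverse h * q * h) = qRe q"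
proof -
  \<comment> \<open>The real part behaves like a trace, so \<open>h\<close> can be moved cyclically
    to meet \<open>inverse h\<close>.\<close>
  have "qRe (a * b) = qRe (b * a)" for a b
    by (simp add: quat_times_components algebra_simps)
  from this[of "inverse h * q" h] show ?thesis
    using assms by (simp flip: mult.assoc)
qed

lemma similar_quat_invariants:
  assumes "similar_quat p q"
  shows "qRe p = qRe q" "quat_norm_sq p = quat_norm_sq q"
proof -
  from assms obtain h where h: "h \<noteq> 0" "p = inverse h * q * h"
    by (auto simp: similar_quat_def)
  then show "qRe p = qRe q"
    by (simp add: qRe_conj_similar)
  have "h * p = q * h"
    using h by (simp add: mult.assoc[symmetric])
  then have "quat_norm_sq h * quat_norm_sq p = quat_norm_sq q * quat_norm_sq h"
    by (metis quat_norm_sq_mult)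
  then show "quat_norm_sq p = quat_norm_sq q"
    using h(1) by simp
qed

lemma similar_quatI:
  assumes "h \<noteq> 0" "h * p = q * h"
  shows "similar_quat p q"
  unfolding similar_quat_def
proof (intro exI conjI)
  show "p = inverse h * q * h"
    by (metis assms left_inverse mult.assoc mult_1)
qed (fact assms(1))

lemma similar_quat_refl: "similar_quat q q"
  by (rule similar_quatI[of 1]) auto

lemma similar_quat_sym:
  assumes "similar_quat p q"
  shows "similar_quat q p"
proof -
  from assms obtain h where h: "h \<noteq> 0" "p = inverse h * q * h"
    by (auto simp: similar_quat_def)
  then have "h * p = q * h"
    by (simp add: mult.assoc[symmetric])
  then have "inverse h * q = p * inverse h"
    by (metis h mult.assoc right_inverse mult.right_neutral)
  then show ?thesis
    using h(1) by (intro similar_quatI[of "inverse h"]) auto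
qed

lemma similar_quat_trans:
  assumes "similar_quat p q" "similar_quat q r"
  shows "similar_quat p r"
proof -
  from assms obtain g h where gh: "g \<noteq> 0" "p = inverse g * q * g" "h \<noteq> 0" "q = inverse h * r * h"
    by (auto simp: similar_quat_def)
  have "p = inverse (h * g) * r * (h * g)"
    using gh by (simp add: nonzero_inverse_mult_distrib mult.assoc)
  moreover have "h * g \<noteq> 0"
    using gh by simp
  ultimately show ?thesis
    unfolding similar_quat_def by blast
qed

text \<open>A complex number a + bi with b \<ge> 0 can be recovered from a and a^2 + b^2, and both
  are invariants of similarity.\<close>

lemma upper_complex_similar_eq:
  assumes "p \<in> upper_complex" "q \<in> upper_complex" "similar_quat p q"
  shows "p = q"
  using assms similar_quat_invariants[OF assms(3)]
  by (auto simp: upper_complex_def quat_norm_sq_def power2_eq_iff)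

text \<open>For q = a + v with v purely imaginary and b = |v|, the representative is z = a + bi.
  Since v^2 = -b^2 = (bi)^2, the element h = v + bi satisfies h (bi) = v h, so it conjugates q into
  z unless it vanishes.\<close>

lemma ex_upper_complex_similar:
  obtains z where "z \<in> upper_complex" "similar_quat z q"
proof -
  define b where "b = sqrt ((qI q)\<^sup>2 + (qJ q)\<^sup>2 + (qK q)\<^sup>2)"
  have b: "b \<ge> 0" "b * b = qI q * qI q + qJ q * qJ q + qK q * qK q"
    by (simp_all add: b_def flip: power2_eq_square)
  define z where "z = Quat (qRe q) b 0 0"
  define h where "h = Quat 0 (qI q + b) (qJ q) (qK q)"
  have z: "z \<in> upper_complex"
    using b(1) by (auto simp: z_def upper_complex_def)
  consider "h \<noteq> 0" | "b = 0" "h = 0" | "b \<noteq> 0" "h = 0"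
    by blast
  then have "similar_quat z q"
  proof cases
    case 1
    have "h * z = q * h"
      using b(2) by (simp add: h_def z_def quat_arith)
    with 1 show ?thesis
      by (rule similar_quatI)
  next
    case 2
    then have "z = q"
      by (simp add: h_def z_def quat_eq_iff)
    then show ?thesis
      by (simp add: similar_quat_refl)
  next
    case 3
    \<comment> \<open>Here q = a - bi, and the unit j intertwines q with its complex conjugate
      z.\<close>
    then have "Quat 0 0 1 0 * z = q * Quat 0 0 1 0"
      by (simp add: h_def z_def quat_arith)
    moreover have "Quat 0 0 1 0 \<noteq> 0"
      by (simp add: quat_eq_iff)
    ultimately show ?thesis
      by (metis similar_quatI)
  qed
  with z that show thesis
    by blast
qed

text \<open>Existence and uniqueness of the representative justify the definite description in
  \<open>class_rep\<close>. Later arguments use \<open>class_rep\<close> only through this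
  equivalence.\<close>

lemma eq_class_rep_iff:
  assumes "z \<in> upper_complex"
  shows "z = class_rep q \<longleftrightarrow> similar_quat z q"
proof -
  obtain y where y: "y \<in> upper_complex" "similar_quat y q"
    by (rule ex_upper_complex_similar)
  have "class_rep q = y"
    unfolding class_rep_def
    using y upper_complex_similar_eq similar_quat_trans similar_quat_sym
    by (intro the_equality) blast+
  then show ?thesis
    using y assms upper_complex_similar_eq similar_quat_trans similar_quat_sym by blast
qed

text \<open>Real factors are central, so rescaling \<open>h\<close> to norm 1 does not affect the
  conjugation, and the inverse of a unit quaternion is its conjugate. The resulting \<open>u\<close>
  can serve as a one by one unitary block.\<close>

lemma ex_unit_similar_upper_complex:
  obtains u where "quat_norm_sq u = 1" "conjugate u * q * u \<in> upper_complex"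
proof -
  obtain z h where z: "z \<in> upper_complex" and h: "h \<noteq> 0" "z = inverse h * q * h"
    using ex_upper_complex_similar unfolding similar_quat_def by metis
  define u where "u = h * quat_of_real (1 / sqrt (quat_norm_sq h))"
  have norm: "quat_norm_sq u = 1"
    using h(1) by (simp add: u_def quat_norm_sq_mult power_divide)
  have "h * z = q * h"
    using h by (simp add: mult.assoc[symmetric])
  then have "u * z = q * u"
    unfolding u_def by (metis mult.assoc quat_of_real_commute)
  then have "conjugate u * q * u = z"
    using norm quat_mult_conjugate(2)[of u]
    by (metis mult.assoc mult_1 quat_of_real_arith(4))
  with norm z that show thesis
    by blast
qed

section \<open>Dimension of right vector spaces\<close>

text \<open>Gaussian elimination, by induction on the number of equations: a pivot in the last
  equation eliminates one unknown from the others. Coefficients stay on the left of the unknowns, so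
  no products are ever commuted.\<close>

lemma homogeneous_system_nontrivial_solution:
  fixes a :: "nat \<Rightarrow> nat \<Rightarrow> 'a :: division_ring"
  assumes "m < k"
  shows "\<exists>x. (\<exists>i<k. x i \<noteq> 0) \<and> (\<forall>j<m. (\<Sum>i<k. a j i * x i) = 0)"
  using assms
proof (induction m arbitrary: k a)
  case 0
  then show ?case
    by (intro exI[of _ "\<lambda>_. 1"]) auto
next
  case (Suc m)
  show ?case
  proof (cases "\<forall>i<k. a m i = 0")
    case True
    from Suc.IH[of k a] Suc.prems obtain x where
      x: "\<exists>i<k. x i \<noteq> 0" "\<forall>j<m. (\<Sum>i<k. a j i * x i) = 0"
      by auto
    moreover have "(\<Sum>i<k. a m i * x i) = 0"
      using True by simp
    ultimately show ?thesis
      by (auto simp: less_Suc_eq intro!: exI[of _ x])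
  next
    case False
    then obtain p where p: "p < k" "a m p \<noteq> 0"
      by blast
    \<comment> \<open>The last row divided from the left by its pivot; the last equation then
      expresses the unknown at \<open>p\<close> through the others.\<close>
    define c where "c i = inverse (a m p) * a m i" for i
    obtain k' where k': "k = Suc k'" "m < k'"
      using Suc.prems by (cases k) auto
    \<comment> \<open>\<open>f\<close> enumerates in increasing order the \<open>k'\<close> indices
      different from the pivot.\<close>
    define f where "f i = (if i < p then i else Suc i)" for i
    have f: "bij_betw f {..<k'} ({..<k} - {p})"
    proof (rule bij_betw_byWitness[where f' = "\<lambda>i. if i < p then i else i - 1"])
    qed (use p k' in \<open>auto simp: f_def\<close>)
    obtain y where y: "\<exists>i<k'. y i \<noteq> 0"
      "\<forall>j<m. (\<Sum>i<k'. (a j (f i) - a j p * c (f i)) * y i) = 0"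
      using Suc.IH[OF k'(2), of "\<lambda>j i. a j (f i) - a j p * c (f i)"] by auto
    define g where "g = inv_into {..<k'} f"
    have gf: "g (f i) = i" if "i < k'" for i
      using f that by (simp add: g_def bij_betw_inv_into_left)
    \<comment> \<open>\<open>x\<close> extends \<open>y\<close> by the value that the last equation
      forces on the pivot unknown.\<close>
    define x where "x i = (if i = p then - (\<Sum>i<k'. c (f i) * y i) else y (g i))" for i
    have fp: "f i \<noteq> p" for i
      by (auto simp: f_def)
    \<comment> \<open>Eliminating the pivot unknown turns any row \<open>b\<close> into a reduced
      row applied to \<open>y\<close>. The last row reduces to zero coefficients, and the earlier
      rows reduce to the system solved by \<open>y\<close>.\<close>
    have sum: "(\<Sum>i<k. b i * x i) = (\<Sum>i<k'. (b (f i) - b p * c (f i)) * y i)" for b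
    proof -
      have "(\<Sum>i<k. b i * x i) = b p * x p + (\<Sum>i\<in>{..<k} - {p}. b i * x i)"
        using p(1) by (subst sum.remove[of _ p]) auto
      also have "(\<Sum>i\<in>{..<k} - {p}. b i * x i) = (\<Sum>i<k'. b (f i) * x (f i))"
        by (rule sum.reindex_bij_betw[OF f, symmetric])
      also have "\<dots> = (\<Sum>i<k'. b (f i) * y i)"
        by (intro sum.cong) (auto simp: x_def gf fp)
      finally show ?thesis
        by (simp add: x_def sum_distrib_left sum_subtractf left_diff_distrib mult.assoc)
    qed
    have "(\<Sum>i<k. a j i * x i) = 0" if "j < Suc m" for j
    proof (cases "j = m")
      case True
      have "a m p * c i = a m i" for i
        using p(2) by (simp add: c_def mult.assoc[symmetric])
      then show ?thesis
        by (simp add: sum True)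
    next
      case False
      then show ?thesis
        using that y(2) by (simp add: sum)
    qed
    moreover have "\<exists>i<k. x i \<noteq> 0"
    proof -
      from y(1) obtain i where i: "i < k'" "y i \<noteq> 0"
        by blast
      moreover have "f i < k"
        using f i(1) by (auto simp: bij_betw_def)
      ultimately show ?thesis
        by (intro exI[of _ "f i"]) (simp add: x_def gf fp)
    qed
    ultimately show ?thesis
      by blast
  qed
qed

section \<open>Linear combinations and bases with scalars on the right\<close>

lemma rsmult_vec_simps [simp]:
  "dim_vec (rsmult_vec x q) = dim_vec x"
  "i < dim_vec x \<Longrightarrow> rsmult_vec x q $ i = x $ i * q"
  "rsmult_vec x q \<in> carrier_vec n \<longleftrightarrow> x \<in> carrier_vec n"
  by (simp_all add: rsmult_vec_def)

lemma sum_list_vec_carrier: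
  assumes "set xs \<subseteq> carrier_vec n"
  shows "sum_list_vec n xs \<in> carrier_vec n"
  using assms by (induction xs) (auto simp: sum_list_vec_def)

lemma index_sum_list_vec:
  assumes "set xs \<subseteq> carrier_vec n" "i < n"
  shows "sum_list_vec n xs $ i = sum_list (map (\<lambda>x. x $ i) xs)"
  using assms
proof (induction xs)
  case (Cons x xs)
  then have "sum_list_vec n xs \<in> carrier_vec n"
    by (intro sum_list_vec_carrier) auto
  with Cons show ?case
    by (simp add: sum_list_vec_def)
qed (simp add: sum_list_vec_def)

lemma right_lincomb_carrier:
  assumes "set bs \<subseteq> carrier_vec n"
  shows "right_lincomb n bs c \<in> carrier_vec n"
  using assms unfolding right_lincomb_def
  by (intro sum_list_vec_carrier) (auto intro!: subsetD[OF assms(1) nth_mem])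

lemma index_right_lincomb:
  assumes "set bs \<subseteq> carrier_vec n" "i < n"
  shows "right_lincomb n bs c $ i = (\<Sum>k<length bs. bs ! k $ i * c k)"
proof -
  have dim: "dim_vec (bs ! k) = n" if "k < length bs" for k
    using assms(1) that by (meson carrier_vecD nth_mem subsetD)
  have "right_lincomb n bs c $ i =
      sum_list (map (\<lambda>x. x $ i) (map (\<lambda>k. rsmult_vec (bs ! k) (c k)) [0..<length bs]))"
    unfolding right_lincomb_def using assms
    by (intro index_sum_list_vec) (auto intro!: subsetD[OF assms(1) nth_mem])
  also have "\<dots> = (\<Sum>k\<in>{0..<length bs}. rsmult_vec (bs ! k) (c k) $ i)"
    by (simp add: sum_list_distinct_conv_sum_set comp_def)
  also have "\<dots> = (\<Sum>k<length bs. bs ! k $ i * c k)"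
    using assms dim by (intro sum.cong) auto
  finally show ?thesis .
qed

text \<open>If \<open>cs\<close> were longer, expressing its vectors through \<open>bs\<close> would
  give a homogeneous system with more unknowns than equations. A nontrivial solution is a nontrivial
  linear relation among the vectors of \<open>cs\<close>.\<close>

lemma right_basis_length_le:
  assumes V: "V \<subseteq> carrier_vec n"
    and bs: "right_basis n V bs" and cs: "right_basis n V cs"
  shows "length cs \<le> length bs"
proof (rule ccontr)
  assume "\<not> length cs \<le> length bs"
  then have less: "length bs < length cs"
    by simp
  have sub: "set bs \<subseteq> carrier_vec n" "set cs \<subseteq> carrier_vec n"
    using V bs cs by (auto simp: right_basis_def)
  have "\<exists>c. cs ! i = right_lincomb n bs c" if "i < length cs" for i
    using bs cs that nth_mem[OF that] unfolding right_basis_def by blast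
  then obtain a where a: "\<And>i. i < length cs \<Longrightarrow> cs ! i = right_lincomb n bs (a i)"
    by metis
  obtain x where x: "\<exists>i<length cs. x i \<noteq> 0"
    "\<forall>j<length bs. (\<Sum>i<length cs. a i j * x i) = 0"
    using homogeneous_system_nontrivial_solution[OF less, of "\<lambda>j i. a i j"] by auto
  have "right_lincomb n cs x = 0\<^sub>v n"
  proof (rule eq_vecI)
    fix r assume "r < dim_vec (0\<^sub>v n :: quat vec)"
    then have r: "r < n"
      by simp
    have "right_lincomb n cs x $ r = (\<Sum>i<length cs. (\<Sum>j<length bs. bs ! j $ r * a i j) * x i)"
      using r sub a by (simp add: index_right_lincomb)
    also have "\<dots> = (\<Sum>j<length bs. bs ! j $ r * (\<Sum>i<length cs. a i j * x i))"
      by (simp add: sum_distrib_left sum_distrib_right mult.assoc sum.swap[of _ "{..<length cs}"])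
    finally show "right_lincomb n cs x $ r = 0\<^sub>v n $ r"
      using x(2) r by simp
  qed (use right_lincomb_carrier[OF sub(2), of x] in auto)
  then show False
    using cs x(1) unfolding right_basis_def by blast
qed

text \<open>The length bound, applied in both directions, makes the number described by
  \<open>right_dim\<close> unique.\<close>

lemma right_dim_eq_length:
  assumes "V \<subseteq> carrier_vec n" "right_basis n V bs"
  shows "right_dim n V = length bs"
  unfolding right_dim_def
  using assms right_basis_length_le[OF assms(1)] by (intro the_equality) (auto intro!: le_antisym)

section \<open>Existence of right eigenvalues\<close>

text \<open>
  The decomposition \<open>q = quat_fst q + j * quat_snd q\<close>: with \<open>j\<close> on the left, right
  multiplication by a complex number acts componentwise.
\<close>

definition quat_fst :: "quat \<Rightarrow> complex"
  where "quat_fst q = Complex (qRe q) (qI q)"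

definition quat_snd :: "quat \<Rightarrow> complex"
  where "quat_snd q = Complex (qJ q) (- qK q)"

definition quat_of_complexes :: "complex \<Rightarrow> complex \<Rightarrow> quat"
  where "quat_of_complexes u w = Quat (Re u) (Im u) (Re w) (- Im w)"

lemma quat_fst_snd_simps [simp]:
  "quat_fst (quat_of_complexes u w) = u" "quat_snd (quat_of_complexes u w) = w"
  "quat_fst 0 = 0" "quat_snd 0 = 0"
  "quat_fst (p + q) = quat_fst p + quat_fst q" "quat_snd (p + q) = quat_snd p + quat_snd q"
  by (simp_all add: quat_fst_def quat_snd_def quat_of_complexes_def complex_eq_iff)

text \<open>Moving a complex number z past j conjugates it, z j = j (\<open>cnj\<close> z), and j^2
  = -1. This accounts for the conjugates and the minus sign.\<close>

lemma quat_fst_snd_mult: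
  "quat_fst (p * q) = quat_fst p * quat_fst q - cnj (quat_snd p) * quat_snd q"
  "quat_snd (p * q) = quat_snd p * quat_fst q + cnj (quat_fst p) * quat_snd q"
  by (simp_all add: quat_fst_def quat_snd_def complex_eq_iff quat_times_components)

lemma quat_eq_fst_snd: "p = q \<longleftrightarrow> quat_fst p = quat_fst q \<and> quat_snd p = quat_snd q"
  by (auto simp: quat_fst_def quat_snd_def quat_eq_iff)

lemma quat_fst_snd_sum:
  "quat_fst (\<Sum>i\<in>S. f i) = (\<Sum>i\<in>S. quat_fst (f i))"
  "quat_snd (\<Sum>i\<in>S. f i) = (\<Sum>i\<in>S. quat_snd (f i))"
  by (induction S rule: infinite_finite_induct) simp_all

text \<open>With A = B + jC and x = a + jb, the equation A x = x k for complex k becomes an ordinary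
  complex eigenvalue equation for the pair (a, b), because the right factor k scales a and b alike.
  A complex matrix of positive size has an eigenvalue.\<close>

lemma ex_right_eigenvalue:
  assumes A: "A \<in> carrier_mat n n" and n: "n > 0"
  shows "\<exists>q. right_eigenvalue A q"
proof -
  define B where "B = map_mat quat_fst A"
  define C where "C = map_mat quat_snd A"
  define D where "D = map_mat (\<lambda>z. - cnj z) C"
  define E where "E = map_mat cnj B"
  have car: "B \<in> carrier_mat n n" "C \<in> carrier_mat n n" "D \<in> carrier_mat n n" "E \<in> carrier_mat n n"
    using A by (auto simp: B_def C_def D_def E_def)
  \<comment> \<open>The upper block row computes the complex part of A x, the lower one the
    coefficient of j in A x.\<close>
  define M where "M = four_block_mat B D C E"
  have M: "M \<in> carrier_mat (n + n) (n + n)"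
    using car by (simp add: M_def)
  then obtain k where "eigenvalue M k"
    using spectrum_non_empty[of M "n + n"] n unfolding spectrum_def by auto
  then obtain v where v: "v \<in> carrier_vec (n + n)" "v \<noteq> 0\<^sub>v (n + n)" "M *\<^sub>v v = k \<cdot>\<^sub>v v"
    using M by (auto simp: eigenvalue_def eigenvector_def)
  define a where "a = vec_first v n"
  define b where "b = vec_last v n"
  have ab: "a \<in> carrier_vec n" "b \<in> carrier_vec n" "v = a @\<^sub>v b"
    using v(1) by (auto simp: a_def b_def)
  have "M *\<^sub>v v = (B *\<^sub>v a + D *\<^sub>v b) @\<^sub>v (C *\<^sub>v a + E *\<^sub>v b)"
    unfolding M_def ab(3) by (rule four_block_mat_mult_vec[OF car(1,3,2,4) ab(1,2)])
  moreover have "k \<cdot>\<^sub>v v = (k \<cdot>\<^sub>v a) @\<^sub>v (k \<cdot>\<^sub>v b)"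
    unfolding ab(3) by (intro eq_vecI) auto
  ultimately have "(B *\<^sub>v a + D *\<^sub>v b) @\<^sub>v (C *\<^sub>v a + E *\<^sub>v b) = (k \<cdot>\<^sub>v a) @\<^sub>v (k \<cdot>\<^sub>v b)"
    using v(3) by simp
  then have eqs: "B *\<^sub>v a + D *\<^sub>v b = k \<cdot>\<^sub>v a" "C *\<^sub>v a + E *\<^sub>v b = k \<cdot>\<^sub>v b"
    using ab car append_vec_eq[of "B *\<^sub>v a + D *\<^sub>v b" n "k \<cdot>\<^sub>v a"] by auto
  define x where "x = vec n (\<lambda>i. quat_of_complexes (a $ i) (b $ i))"
  define q where "q = quat_of_complexes k 0"
  have "A *\<^sub>v x = rsmult_vec x q"
  proof (rule eq_vecI)
    fix i assume "i < dim_vec (rsmult_vec x q)"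
    then have i: "i < n"
      by (simp add: x_def rsmult_vec_def)
    have "k * a $ i = (B *\<^sub>v a + D *\<^sub>v b) $ i" "k * b $ i = (C *\<^sub>v a + E *\<^sub>v b) $ i"
      unfolding eqs using ab i by simp_all
    then have "k * a $ i = (\<Sum>j=0..<n. quat_fst (A $$ (i, j)) * a $ j - cnj (quat_snd (A $$ (i, j))) * b $ j)"
      "k * b $ i = (\<Sum>j=0..<n. quat_snd (A $$ (i, j)) * a $ j + cnj (quat_fst (A $$ (i, j))) * b $ j)"
      using A ab i by (simp_all add: scalar_prod_def B_def C_def D_def E_def sum.distrib sum_subtractf sum_negf)
    then show "(A *\<^sub>v x) $ i = rsmult_vec x q $ i"
      using A i by (simp add: quat_eq_fst_snd x_def q_def rsmult_vec_def scalar_prod_def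
          quat_fst_snd_sum quat_fst_snd_mult mult.commute)
  qed (use A in \<open>auto simp: x_def rsmult_vec_def\<close>)
  moreover have "x \<noteq> 0\<^sub>v n"
  proof
    assume x: "x = 0\<^sub>v n"
    have "a $ i = 0 \<and> b $ i = 0" if "i < n" for i
      using arg_cong[OF x, of "\<lambda>y. quat_fst (y $ i)"] arg_cong[OF x, of "\<lambda>y. quat_snd (y $ i)"] that
      by (simp add: x_def)
    then have "v = 0\<^sub>v (n + n)"
      unfolding ab(3) using ab by (intro eq_vecI) auto
    with v(2) show False ..
  qed
  ultimately show ?thesis
    using A unfolding right_eigenvalue_def by (intro exI[of _ q] bexI[of _ x]) (auto simp: x_def)
qed

section \<open>Unitary triangularization\<close>

lemma conj_transpose_simps [simp]:
  "dim_row (conj_transpose A) = dim_col A" "dim_col (conj_transpose A) = dim_row A"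
  "i < dim_col A \<Longrightarrow> j < dim_row A \<Longrightarrow> conj_transpose A $$ (i, j) = conjugate (A $$ (j, i))"
  "conj_transpose A \<in> carrier_mat m n \<longleftrightarrow> A \<in> carrier_mat n m"
  by (auto simp: conj_transpose_def)

lemma conj_transpose_conj_transpose [simp]: "conj_transpose (conj_transpose A) = A"
  by (intro eq_matI) auto

lemma conj_transpose_mult:
  assumes "A \<in> carrier_mat m k" "B \<in> carrier_mat k n"
  shows "conj_transpose (A * B) = conj_transpose B * conj_transpose A"
  using assms by (intro eq_matI) (auto simp: scalar_prod_def quat_conjugate_sum)

lemma conj_transpose_four_block:
  assumes "A \<in> carrier_mat k l" "B \<in> carrier_mat k n" "C \<in> carrier_mat m l" "D \<in> carrier_mat m n"
  shows "conj_transpose (four_block_mat A B C D) =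
    four_block_mat (conj_transpose A) (conj_transpose C) (conj_transpose B) (conj_transpose D)"
  using assms by (intro eq_matI) auto

lemma unitary_mat_mult:
  assumes "unitary_mat n U" "unitary_mat n V"
  shows "unitary_mat n (U * V)"
proof -
  let ?U = "conj_transpose U" and ?V = "conj_transpose V"
  note [simp] = assms[unfolded unitary_mat_def]
  have "?V * ?U * (U * V) = ?V * (?U * U) * V" "U * V * (?V * ?U) = U * (V * ?V) * ?U"
    using assms unfolding unitary_mat_def by (smt (verit) assoc_mult_mat conj_transpose_simps(4) mult_carrier_mat)+
  then show ?thesis
    by (simp add: unitary_mat_def conj_transpose_mult[of _ n n _ n] right_mult_one_mat[of _ n n]
        mult_carrier_mat[of _ n n])
qed

section \<open>Splitting off a right eigenvector by a reflection\<close>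

lemma mult_mat_vec_rsmult:
  assumes "A \<in> carrier_mat m n" "x \<in> carrier_vec n"
  shows "A *\<^sub>v rsmult_vec x q = rsmult_vec (A *\<^sub>v x) q"
  using assms by (intro eq_vecI) (auto simp: scalar_prod_def sum_distrib_right mult.assoc)

text \<open>
  The Householder reflection along \<open>x - e\<^sub>0\<close>. It maps \<open>e\<^sub>0\<close> to \<open>x\<close> only because \<open>x $ 0\<close> is
  real, and the sign condition on \<open>x $ 0\<close> excludes the degenerate case \<open>x = e\<^sub>0\<close>.
\<close>

lemma ex_unitary_with_first_col:
  assumes x: "x \<in> carrier_vec n" and n: "0 < n"
    and norm: "(\<Sum>i<n. quat_norm_sq (x $ i)) = 1"
    and x0: "x $ 0 = quat_of_real t" and t: "t \<le> 0"
  shows "\<exists>H. unitary_mat n H \<and> col H 0 = x"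
proof -
  define w where "w i = x $ i - of_bool (i = 0)" for i
  \<comment> \<open>This is 2 divided by the squared norm of \<open>w\<close>, which turns out to be
    2 (1 - t). Thus \<open>P\<close> is twice the orthogonal projection onto the line of
    \<open>w\<close>.\<close>
  define c where "c = 1 / (1 - t)"
  define P where "P = mat n n (\<lambda>(i, j). w i * quat_of_real c * conjugate (w j))"
  define H where "H = 1\<^sub>m n - P"
  have car: "P \<in> carrier_mat n n" "H \<in> carrier_mat n n"
    by (auto simp: P_def H_def minus_mat_def)
  have herm: "conj_transpose H = H"
    by (intro eq_matI) (auto simp: H_def P_def mult.assoc)
  have w0: "w 0 = quat_of_real (t - 1)"
    by (simp add: w_def x0 quat_eq_iff)
  have "(\<Sum>i<n. quat_norm_sq (w i)) = quat_norm_sq (w 0) + (\<Sum>i\<in>{..<n} - {0}. quat_norm_sq (w i))"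
    using n by (subst sum.remove[of _ 0]) auto
  also have "(\<Sum>i\<in>{..<n} - {0}. quat_norm_sq (w i)) = (\<Sum>i\<in>{..<n} - {0}. quat_norm_sq (x $ i))"
    by (intro sum.cong) (auto simp: w_def)
  also have "\<dots> = 1 - quat_norm_sq (x $ 0)"
    using n norm by (simp add: sum.remove[of "{..<n}" 0])
  finally have w_norm: "(\<Sum>i<n. quat_norm_sq (w i)) = 2 * (1 - t)"
    by (simp add: w0 x0 power2_eq_square algebra_simps)
  \<comment> \<open>Because of this identity \<open>H\<close> squares to the identity matrix; being
    Hermitian as well, it is unitary.\<close>
  have PP: "P * P = P + P"
  proof (rule eq_matI)
    fix i j assume "i < dim_row (P + P)" "j < dim_col (P + P)"
    then have ij: "i < n" "j < n"
      using car by auto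
    have "(P * P) $$ (i, j) =
        (\<Sum>k<n. w i * quat_of_real c * (conjugate (w k) * w k) * quat_of_real c * conjugate (w j))"
      using ij by (simp add: P_def scalar_prod_def lessThan_atLeast0 mult.assoc)
    also have "\<dots> = w i * quat_of_real c * quat_of_real (2 * (1 - t)) * quat_of_real c * conjugate (w j)"
      by (simp only: sum_distrib_left[symmetric] sum_distrib_right[symmetric]
          quat_mult_conjugate quat_of_real_sum[symmetric] w_norm)
    also have "\<dots> = w i * quat_of_real (2 * c) * conjugate (w j)"
    proof -
      have "c * (1 - t) = 1"
        using t by (simp add: c_def)
      then have "c * (2 * (1 - t) * c) = 2 * c"
        by (metis mult.assoc mult.commute mult_1)
      then show ?thesis
        by (metis mult.assoc quat_of_real_arith(1))
    qed
    also have "quat_of_real (2 * c) = quat_of_real c + quat_of_real c"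
      by simp
    also have "w i * (quat_of_real c + quat_of_real c) * conjugate (w j) = (P + P) $$ (i, j)"
      using ij by (simp only: distrib_left distrib_right) (simp add: P_def)
    finally show "(P * P) $$ (i, j) = (P + P) $$ (i, j)" .
  qed (use car in auto)
  have "H * H = 1\<^sub>m n * (1\<^sub>m n - P) - P * (1\<^sub>m n - P)"
    unfolding H_def using car by (intro minus_mult_distrib_mat) auto
  also have "P * (1\<^sub>m n - P) = P * 1\<^sub>m n - P * P"
    using car by (intro mult_minus_distrib_mat) auto
  also have "1\<^sub>m n * (1\<^sub>m n - P) - (P * 1\<^sub>m n - P * P) = 1\<^sub>m n"
    using car by (intro eq_matI) (auto simp: PP)
  finally have "unitary_mat n H"
    using car by (simp add: unitary_mat_def herm)
  moreover have "col H 0 = x"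
  proof (rule eq_vecI)
    fix i assume "i < dim_vec x"
    then have i: "i < n"
      using x by simp
    \<comment> \<open>The first column of \<open>P\<close> is -w, so the first column of
      \<open>H\<close> is e_0 + w = x.\<close>
    have "w i * quat_of_real c * conjugate (w 0) = w i * quat_of_real (c * (t - 1))"
      by (simp add: w0 mult.assoc)
    also have "c * (t - 1) = -1"
      using t by (simp add: c_def divide_simps)
    also have "w i * quat_of_real (-1) = - w i"
      by (simp add: quat_arith)
    finally show "col H 0 $ i = x $ i"
      using i n car by (simp add: H_def P_def w_def)
  qed (use x car in auto)
  ultimately show ?thesis
    by blast
qed

text \<open>Multiplying a right eigenvector for p on the right by s \<noteq> 0 gives a right
  eigenvector for \<open>inverse s * p * s\<close>. Hence its length and the phase of its first
  entry can be chosen to suit the reflection.\<close>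

lemma ex_unit_right_eigenvector:
  assumes A: "A \<in> carrier_mat n n" and n: "0 < n"
  obtains x q t where "x \<in> carrier_vec n" "A *\<^sub>v x = rsmult_vec x q"
    "(\<Sum>i<n. quat_norm_sq (x $ i)) = 1" "x $ 0 = quat_of_real t" "t \<le> 0"
proof -
  obtain y p where y: "y \<in> carrier_vec n" "y \<noteq> 0\<^sub>v n" "A *\<^sub>v y = rsmult_vec y p"
    using ex_right_eigenvalue[OF A n] A by (auto simp: right_eigenvalue_def)
  define N where "N = (\<Sum>i<n. quat_norm_sq (y $ i))"
  have "N \<noteq> 0"
  proof
    assume "N = 0"
    then have "y $ i = 0" if "i < n" for i
      using that by (auto simp: N_def sum_nonneg_eq_0_iff)
    then have "y = 0\<^sub>v n"
      using y(1) by (intro eq_vecI) auto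
    with y(2) show False ..
  qed
  then have N: "N > 0"
    using sum_nonneg[of "{..<n}" "\<lambda>i. quat_norm_sq (y $ i)"] by (simp add: N_def less_le)
  \<comment> \<open>Right multiplication by the conjugate makes the first entry real and
    nonnegative; if that entry vanishes, the value 1 keeps \<open>u\<close> invertible.\<close>
  define u where "u = (if y $ 0 = 0 then 1 else conjugate (y $ 0))"
  have u: "u \<noteq> 0" "quat_norm_sq u > 0"
    by (simp_all add: u_def flip: quat_norm_sq_pos_iff)
  have y0: "y $ 0 * u = quat_of_real (quat_norm_sq (y $ 0))"
    by (auto simp: u_def quat_mult_conjugate)
  \<comment> \<open>The square root normalizes the length, and the minus sign makes the first entry
    nonpositive.\<close>
  define r where "r = - 1 / sqrt (quat_norm_sq u * N)"
  have r: "r \<le> 0" "quat_norm_sq u * N * r\<^sup>2 = 1"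
    using u N by (simp_all add: r_def power_divide)
  define s where "s = u * quat_of_real r"
  have s: "s \<noteq> 0" "quat_norm_sq s * N = 1"
    using r(2) by (auto simp: s_def quat_norm_sq_mult ac_simps simp flip: quat_norm_sq_eq_0_iff)
  show thesis
  proof
    show "rsmult_vec y s \<in> carrier_vec n"
      using y by simp
    have "A *\<^sub>v rsmult_vec y s = rsmult_vec (rsmult_vec y p) s"
      using A y by (simp add: mult_mat_vec_rsmult)
    also have "\<dots> = rsmult_vec (rsmult_vec y s) (inverse s * p * s)"
      using s(1) by (intro eq_vecI) (simp_all add: mult.assoc[symmetric], simp add: mult.assoc)
    finally show "A *\<^sub>v rsmult_vec y s = \<dots>" .
    show "(\<Sum>i<n. quat_norm_sq (rsmult_vec y s $ i)) = 1"
      using y(1) s(2) by (simp add: quat_norm_sq_mult N_def sum_distrib_left mult.commute)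
    show "rsmult_vec y s $ 0 = quat_of_real (quat_norm_sq (y $ 0) * r)"
      using y(1) n by (simp add: s_def mult.assoc[symmetric] y0)
    show "quat_norm_sq (y $ 0) * r \<le> 0"
      using r(1) by (simp add: mult_nonneg_nonpos)
  qed
qed

text \<open>Induction on the size. A reflection \<open>H\<close> whose first column is a unit right
  eigenvector clears the first column of \<open>B\<close> below the corner. The induction hypothesis
  triangularizes the lower right block by \<open>V\<close>, and a unit quaternion \<open>u\<close>
  moves the corner into \<open>upper_complex\<close>. The required unitary matrix is
  \<open>H\<close> times the block diagonal matrix of \<open>u\<close> and \<open>V\<close>.\<close>

lemma ex_unitary_triangularization:
  assumes "A \<in> carrier_mat n n"
  shows "\<exists>U. unitary_mat n U \<and> upper_triangular (conj_transpose U * A * U) \<and>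
    (\<forall>i<n. (conj_transpose U * A * U) $$ (i, i) \<in> upper_complex)"
  using assms
proof (induction n arbitrary: A)
  case 0
  have "conj_transpose (1\<^sub>m 0) = 1\<^sub>m 0"
    by (intro eq_matI) auto
  then show ?case
    using 0 by (intro exI[of _ "1\<^sub>m 0"]) (auto simp: unitary_mat_def)
next
  case (Suc n)
  note A = \<open>A \<in> carrier_mat (Suc n) (Suc n)\<close>
  obtain x q t where x: "x \<in> carrier_vec (Suc n)" "A *\<^sub>v x = rsmult_vec x q"
    "(\<Sum>i<Suc n. quat_norm_sq (x $ i)) = 1" "x $ 0 = quat_of_real t" "t \<le> 0"
    using ex_unit_right_eigenvector[OF A] by blast
  obtain H where H: "unitary_mat (Suc n) H" "col H 0 = x"
    using ex_unitary_with_first_col[OF x(1) _ x(3,4,5)] by auto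
  have Hcar: "H \<in> carrier_mat (Suc n) (Suc n)" "conj_transpose H * H = 1\<^sub>m (Suc n)"
    using H by (auto simp: unitary_mat_def)
  define B where "B = conj_transpose H * A * H"
  have B: "B \<in> carrier_mat (Suc n) (Suc n)"
    using Hcar A by (auto simp: B_def)
  have "conj_transpose H *\<^sub>v x = col (conj_transpose H * H) 0"
    using Hcar H by (subst col_mult2[of _ "Suc n" "Suc n" _ "Suc n"]) auto
  then have Hx: "conj_transpose H *\<^sub>v x = unit_vec (Suc n) 0"
    using Hcar by simp
  have "col B 0 = (conj_transpose H * A) *\<^sub>v x"
    unfolding B_def using A Hcar H by (subst col_mult2[of _ "Suc n" "Suc n" _ "Suc n"]) auto
  also have "\<dots> = rsmult_vec (unit_vec (Suc n) 0) q"
    using A Hcar x by (simp add: assoc_mult_mat_vec[of _ "Suc n" "Suc n" _ "Suc n"]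
        mult_mat_vec_rsmult[of _ "Suc n" "Suc n"] Hx)
  finally have colB: "col B 0 = rsmult_vec (unit_vec (Suc n) 0) q" .
  obtain B1 B2 B3 B4 where split: "split_block B 1 1 = (B1, B2, B3, B4)"
    by (cases "split_block B 1 1") auto
  from split_block[OF split, of n n] B have Bs: "B1 \<in> carrier_mat 1 1" "B2 \<in> carrier_mat 1 n"
    "B3 \<in> carrier_mat n 1" "B4 \<in> carrier_mat n n" "B = four_block_mat B1 B2 B3 B4"
    by auto
  have B3: "B3 = 0\<^sub>m n 1"
  proof (rule eq_matI)
    fix i j assume "i < dim_row (0\<^sub>m n 1 :: quat mat)" "j < dim_col (0\<^sub>m n 1 :: quat mat)"
    then have ij: "i < n" "j = 0"
      by auto
    have "B3 $$ (i, j) = col B 0 $ Suc i"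
      using ij B Bs(1,2,3,4) by (subst Bs(5)) auto
    then show "B3 $$ (i, j) = 0\<^sub>m n 1 $$ (i, j)"
      using ij unfolding colB by simp
  qed (use Bs in auto)
  obtain V where V: "unitary_mat n V" "upper_triangular (conj_transpose V * B4 * V)"
    "\<forall>i<n. (conj_transpose V * B4 * V) $$ (i, i) \<in> upper_complex"
    using Suc.IH[OF Bs(4)] by blast
  have Vcar: "V \<in> carrier_mat n n"
    using V by (auto simp: unitary_mat_def)
  obtain u where u: "quat_norm_sq u = 1" "conjugate u * B1 $$ (0, 0) * u \<in> upper_complex"
    by (rule ex_unit_similar_upper_complex)
  define u1 where "u1 = mat 1 1 (\<lambda>_. u)"
  have u1: "u1 \<in> carrier_mat 1 1" "conj_transpose u1 * u1 = 1\<^sub>m 1" "u1 * conj_transpose u1 = 1\<^sub>m 1"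
    using u(1) by (auto simp: u1_def scalar_prod_def quat_mult_conjugate intro!: eq_matI)
  define K where "K = four_block_mat u1 (0\<^sub>m 1 n) (0\<^sub>m n 1) V"
  have conj0: "conj_transpose (0\<^sub>m k l) = 0\<^sub>m l k" for k l
    by (intro eq_matI) auto
  have K': "conj_transpose K = four_block_mat (conj_transpose u1) (0\<^sub>m 1 n) (0\<^sub>m n 1) (conj_transpose V)"
    unfolding K_def using u1(1) Vcar by (subst conj_transpose_four_block) (auto simp: conj0)
  have Kcar: "K \<in> carrier_mat (Suc n) (Suc n)"
    using u1(1) Vcar four_block_carrier_mat[OF u1(1) Vcar] by (auto simp: K_def)
  have "conj_transpose K * K = 1\<^sub>m (1 + n)" "K * conj_transpose K = 1\<^sub>m (1 + n)"
    unfolding K' unfolding K_def using u1 V(1) Vcar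
      mult_four_block_mat[of "conj_transpose u1" 1 1 "0\<^sub>m 1 n" n "0\<^sub>m n 1" n "conj_transpose V" u1 1 "0\<^sub>m 1 n" n "0\<^sub>m n 1" V]
      mult_four_block_mat[of u1 1 1 "0\<^sub>m 1 n" n "0\<^sub>m n 1" n V "conj_transpose u1" 1 "0\<^sub>m 1 n" n "0\<^sub>m n 1" "conj_transpose V"]
    by (simp_all add: unitary_mat_def del: One_nat_def)
  then have K: "unitary_mat (Suc n) K"
    using Kcar by (simp add: unitary_mat_def)
  have T: "conj_transpose (H * K) * A * (H * K) = conj_transpose K * B * K"
    unfolding B_def using A Hcar Kcar
    by (simp add: conj_transpose_mult[of _ "Suc n" "Suc n"]
        assoc_mult_mat[of _ "Suc n" "Suc n" _ "Suc n" _ "Suc n"] mult_carrier_mat[of _ "Suc n" "Suc n"])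
  let ?C = "conj_transpose u1 * B1 * u1" and ?D = "conj_transpose V * B4 * V"
  have "conj_transpose K * B =
      four_block_mat (conj_transpose u1 * B1) (conj_transpose u1 * B2) (0\<^sub>m n 1) (conj_transpose V * B4)"
    unfolding K' unfolding Bs(5) B3 using u1(1) Vcar Bs
    by (subst mult_four_block_mat[of _ 1 1 _ n _ n]) (auto simp: right_add_zero_mat[of _ 1] left_add_zero_mat[of _ n])
  then have KBK: "conj_transpose K * B * K =
      four_block_mat ?C (conj_transpose u1 * B2 * V) (0\<^sub>m n 1) ?D"
    unfolding K_def using u1(1) Vcar Bs
    by (simp, subst mult_four_block_mat[of _ 1 1 _ n _ n]) auto
  have CD: "?C \<in> carrier_mat 1 1" "?D \<in> carrier_mat n n"
    using u1(1) Vcar Bs by auto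
  have "upper_triangular (conj_transpose K * B * K)"
    unfolding KBK using CD V(2) by (intro upper_triangular_four_block) (auto simp: upper_triangular_def)
  moreover have "(conj_transpose K * B * K) $$ (i, i) \<in> upper_complex" if "i < Suc n" for i
  proof (cases i)
    case 0
    have "?C $$ (0, 0) = conjugate u * B1 $$ (0, 0) * u"
      using Bs(1) by (simp add: u1_def scalar_prod_def)
    then show ?thesis
      unfolding KBK using CD u1(1) Vcar 0 u(2) by (subst index_mat_four_block) auto
  next
    case (Suc j)
    then show ?thesis
      unfolding KBK using CD u1(1) Vcar V(3) that by (subst index_mat_four_block) auto
  qed
  ultimately show ?case
    using unitary_mat_mult[OF H(1) K] T by metis
qed

section \<open>Normal matrices\<close>

lemma normal_mat_unitary_conj:
  assumes A: "A \<in> carrier_mat n n" "normal_mat A" and U: "unitary_mat n U"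
  shows "normal_mat (conj_transpose U * A * U)"
proof -
  have Uc: "U \<in> carrier_mat n n" "U * conj_transpose U = 1\<^sub>m n"
    using U by (auto simp: unitary_mat_def)
  have cancel: "U * (conj_transpose U * X) = X" if "X \<in> carrier_mat n n" for X
    using that Uc by (simp flip: assoc_mult_mat[of _ n n _ n _ n])
  \<comment> \<open>With all products bracketed to the right, normality is needed in this
    form.\<close>
  have comm: "A * (conj_transpose A * U) = conj_transpose A * (A * U)"
  proof -
    have "A * (conj_transpose A * U) = A * conj_transpose A * U"
      using A(1) Uc(1) by (intro assoc_mult_mat[symmetric]) auto
    also have "\<dots> = conj_transpose A * A * U"
      using A(2) by (simp only: normal_mat_def)
    also have "\<dots> = conj_transpose A * (A * U)"
      using A(1) Uc(1) by (intro assoc_mult_mat) auto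
    finally show ?thesis .
  qed
  show ?thesis
    using A(1) Uc comm unfolding normal_mat_def
    by (simp add: conj_transpose_mult[of _ n n _ n] assoc_mult_mat[of _ n n _ n _ n]
        mult_carrier_mat[of _ n n] cancel)
qed

text \<open>Comparing the diagonal entries of \<open>T T\<^sup>*\<close> and \<open>T\<^sup>* T\<close> row by row from the top.\<close>

lemma normal_upper_triangular_imp_diagonal:
  assumes T: "T \<in> carrier_mat n n" "normal_mat T" "upper_triangular T"
    and ij: "i < n" "j < n" "i \<noteq> j"
  shows "T $$ (i, j) = 0"
proof -
  have lower: "T $$ (k, i) = 0" if "i < k" "k < n" for i k
    using upper_triangularD[OF T(3)] T(1) that by auto
  have norms: "(\<Sum>k<n. quat_norm_sq (T $$ (i, k))) = (\<Sum>k<n. quat_norm_sq (T $$ (k, i)))"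
    if "i < n" for i
  proof -
    have "qRe ((T * conj_transpose T) $$ (i, i)) = (\<Sum>k<n. quat_norm_sq (T $$ (i, k)))"
      "qRe ((conj_transpose T * T) $$ (i, i)) = (\<Sum>k<n. quat_norm_sq (T $$ (k, i)))"
      using that T(1) by (simp_all add: scalar_prod_def qRe_sum quat_mult_conjugate lessThan_atLeast0)
    then show ?thesis
      using T(2) by (simp add: normal_mat_def)
  qed
  have "\<forall>j<n. i \<noteq> j \<longrightarrow> T $$ (i, j) = 0" if "i < n" for i
    using that
  proof (induction i rule: less_induct)
    case (less i)
    \<comment> \<open>Above the diagonal this is the induction hypothesis for earlier rows, below it
      triangularity. So column i consists of its diagonal entry, and the equality of row and column
      lengths leaves nothing else in row i.\<close>
    have "T $$ (k, i) = 0" if "k < n" "k \<noteq> i" for k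
      using less lower that by (cases "k < i") auto
    then have "(\<Sum>k<n. quat_norm_sq (T $$ (k, i))) = quat_norm_sq (T $$ (i, i))"
      using less.prems by (subst sum.remove[of _ i]) auto
    then have "(\<Sum>k\<in>{..<n} - {i}. quat_norm_sq (T $$ (i, k))) = 0"
      using norms[OF less.prems] less.prems by (simp add: sum.remove[of _ i "\<lambda>k. quat_norm_sq (T $$ (i, k))"])
    then show ?case
      by (auto simp: sum_nonneg_eq_0_iff)
  qed
  with ij show ?thesis
    by blast
qed

section \<open>Eigenspaces in the coordinates given by a Schur form\<close>

context
  fixes A U T :: "quat mat" and n :: nat
  assumes A: "A \<in> carrier_mat n n" and normal: "normal_mat A" and schur: "schur_form A U T"
begin

lemma schur_form_facts:
  "U \<in> carrier_mat n n" "T \<in> carrier_mat n n"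
  "conj_transpose U * U = 1\<^sub>m n" "U * conj_transpose U = 1\<^sub>m n"
  "T = conj_transpose U * A * U" "\<And>i. i < n \<Longrightarrow> T $$ (i, i) \<in> upper_complex"
  using A schur by (auto simp: schur_form_def unitary_mat_def)

lemma schur_form_diagonal:
  assumes "i < n" "j < n" "i \<noteq> j"
  shows "T $$ (i, j) = 0"
  using assms A normal schur schur_form_facts(5) normal_mat_unitary_conj[of A n U]
  by (intro normal_upper_triangular_imp_diagonal[of T n]) (auto simp: schur_form_def)

text \<open>Since \<open>T\<close> is diagonal, this is the identity \<open>A * U = U * T\<close>
  read column by column.\<close>

lemma col_schur_form_eigenvector:
  assumes i: "i < n"
  shows "col U i \<in> eigen_set A (T $$ (i, i))"
proof -
  note facts = schur_form_facts
  have "A * U = U * T"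
  proof -
    have "U * T = U * conj_transpose U * (A * U)"
      unfolding facts(5) using A facts(1) by (simp add: assoc_mult_mat[of _ n n _ n _ n] mult_carrier_mat[of _ n n])
    then show ?thesis
      using A facts by simp
  qed
  then have "A *\<^sub>v col U i = col (U * T) i"
    using A facts(1) i by (metis col_mult2)
  also have "\<dots> = rsmult_vec (col U i) (T $$ (i, i))"
  proof (rule eq_vecI)
    fix r assume "r < dim_vec (rsmult_vec (col U i) (T $$ (i, i)))"
    then have r: "r < n"
      using facts(1) by simp
    have "col (U * T) i $ r = (\<Sum>k<n. U $$ (r, k) * T $$ (k, i))"
      using r i facts by (simp add: scalar_prod_def lessThan_atLeast0)
    also have "\<dots> = U $$ (r, i) * T $$ (i, i)"
      using i schur_form_diagonal by (subst sum.remove[of _ i]) auto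
    finally show "col (U * T) i $ r = rsmult_vec (col U i) (T $$ (i, i)) $ r"
      using r i facts by simp
  qed (use facts in auto)
  finally show ?thesis
    using A facts(1) i by (simp add: eigen_set_def)
qed

text \<open>For \<open>y = conj_transpose U *\<^sub>v x\<close>, the equation A x = x p becomes T y
  = y p. As \<open>T\<close> is diagonal, its i-th entry reads T_ii y_i = y_i p, so a nonzero y_i
  would make T_ii similar to p and hence equal to the class representative.\<close>

lemma eigen_set_coordinate_eq_0:
  assumes x: "x \<in> eigen_set A p" and p: "similar_quat p q"
    and i: "i < n" "T $$ (i, i) \<noteq> class_rep q"
  shows "(conj_transpose U *\<^sub>v x) $ i = 0"
proof (rule ccontr)
  note facts = schur_form_facts
  define y where "y = conj_transpose U *\<^sub>v x"
  assume "(conj_transpose U *\<^sub>v x) $ i \<noteq> 0"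
  then have yi: "y $ i \<noteq> 0"
    by (simp add: y_def)
  have xc: "x \<in> carrier_vec n" "A *\<^sub>v x = rsmult_vec x p"
    using x A by (auto simp: eigen_set_def)
  have y: "y \<in> carrier_vec n"
    using facts(1) xc by (auto simp: y_def)
  have "U *\<^sub>v y = (U * conj_transpose U) *\<^sub>v x"
    unfolding y_def using facts(1) xc by (simp add: assoc_mult_mat_vec[of _ n n _ n])
  then have "U *\<^sub>v y = x"
    using facts xc by simp
  then have "T *\<^sub>v y = conj_transpose U *\<^sub>v (A *\<^sub>v x)"
    unfolding facts(5) using facts(1) A y
    by (simp add: assoc_mult_mat_vec[of _ n n _ n] mult_carrier_mat[of _ n n])
  also have "\<dots> = rsmult_vec y p"
    unfolding xc(2) y_def using facts(1) xc by (simp add: mult_mat_vec_rsmult[of _ n n])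
  finally have "(\<Sum>k<n. T $$ (i, k) * y $ k) = y $ i * p"
    using i y facts(2) by (auto dest!: arg_cong[of _ _ "\<lambda>v. v $ i"] simp: scalar_prod_def lessThan_atLeast0)
  also have "(\<Sum>k<n. T $$ (i, k) * y $ k) = T $$ (i, i) * y $ i"
    using i schur_form_diagonal by (subst sum.remove[of _ i]) auto
  finally have "similar_quat p (T $$ (i, i))"
    using yi by (intro similar_quatI[of "y $ i"]) auto
  then have "similar_quat (T $$ (i, i)) q"
    using p similar_quat_sym similar_quat_trans by blast
  then show False
    using i facts(6) eq_class_rep_iff by blast
qed

lemma class_eigenspace_carrier: "class_eigenspace A q \<subseteq> carrier_vec n"
  using A by (auto simp: class_eigenspace_def eigen_set_def intro!: sum_list_vec_carrier)

text \<open>The vanishing of a coordinate is preserved by finite sums, even when the summands belong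
  to different members of the class.\<close>

lemma class_eigenspace_coordinate_eq_0:
  assumes x: "x \<in> class_eigenspace A q" and i: "i < n" "T $$ (i, i) \<noteq> class_rep q"
  shows "(conj_transpose U *\<^sub>v x) $ i = 0"
proof -
  obtain xs where xs: "x = sum_list_vec n xs" "\<forall>y\<in>set xs. \<exists>p. similar_quat p q \<and> y \<in> eigen_set A p"
    using x A by (auto simp: class_eigenspace_def)
  from xs(2) have "(conj_transpose U *\<^sub>v sum_list_vec n xs) $ i = 0"
  proof (induction xs)
    case Nil
    then show ?case
      using i schur_form_facts(1) by (simp add: sum_list_vec_def)
  next
    case (Cons y ys)
    have car: "set (y # ys) \<subseteq> carrier_vec n"
      using Cons.prems A by (auto simp: eigen_set_def)
    then have "sum_list_vec n ys \<in> carrier_vec n" "y \<in> carrier_vec n"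
      by (auto intro!: sum_list_vec_carrier)
    then have "conj_transpose U *\<^sub>v sum_list_vec n (y # ys) =
        conj_transpose U *\<^sub>v y + conj_transpose U *\<^sub>v sum_list_vec n ys"
      using schur_form_facts(1) by (simp add: sum_list_vec_def mult_add_distrib_mat_vec[of _ n n])
    moreover have "(conj_transpose U *\<^sub>v y) $ i = 0"
      using Cons.prems eigen_set_coordinate_eq_0 i by auto
    ultimately show ?case
      using Cons i schur_form_facts(1) by simp
  qed
  then show ?thesis
    by (simp add: xs(1))
qed

text \<open>Every x is the combination of the columns of \<open>U\<close> with the entries of
  \<open>conj_transpose U *\<^sub>v x\<close> as coefficients, and for x in the class eigenspace
  only the selected columns contribute. Independence follows from orthonormality of the
  columns.\<close>

lemma schur_form_right_basis:
  "right_basis n (class_eigenspace A q)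
    (map (col U) (filter (\<lambda>i. T $$ (i, i) = class_rep q) [0..<n]))"
    (is "right_basis n ?V (map _ ?I)")
proof -
  note facts = schur_form_facts
  have I: "i < n" "T $$ (i, i) = class_rep q" if "i \<in> set ?I" for i
    using that by auto
  have Ik: "?I ! k < n" if "k < length ?I" for k
    using I(1) nth_mem[OF that] .
  have car: "set (map (col U) ?I) \<subseteq> carrier_vec n"
    using facts(1) by auto
  have lincomb: "right_lincomb n (map (col U) ?I) c $ r = (\<Sum>k<length ?I. U $$ (r, ?I ! k) * c k)"
    if "r < n" for r c
    using that facts(1) Ik by (simp add: index_right_lincomb[OF car])
  \<comment> \<open>This converts sums over positions in the filtered list into sums over the
    selected indices themselves.\<close>
  have bij: "bij_betw ((!) ?I) {..<length ?I} (set ?I)"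
    by (intro bij_betw_nth) auto
  have "col U i \<in> ?V" if i: "i \<in> set ?I" for i
  proof -
    have "similar_quat (T $$ (i, i)) q"
      using I[OF i] facts(6) eq_class_rep_iff by blast
    moreover have "col U i = sum_list_vec n [col U i]"
      using facts(1) by (intro eq_vecI) (auto simp: sum_list_vec_def)
    ultimately show ?thesis
      using A I(1)[OF i] col_schur_form_eigenvector unfolding class_eigenspace_def
      by (intro CollectI exI[of _ "[col U i]"]) auto
  qed
  moreover have "\<exists>c. x = right_lincomb n (map (col U) ?I) c" if x: "x \<in> ?V" for x
  proof -
    define y where "y = conj_transpose U *\<^sub>v x"
    define c where "c k = y $ (?I ! k)" for k
    have xc: "x \<in> carrier_vec n"
      using x class_eigenspace_carrier by blast
    have y: "y \<in> carrier_vec n" "x = U *\<^sub>v y"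
      using facts(1,4) xc by (auto simp: y_def simp flip: assoc_mult_mat_vec[of _ n n _ n])
    have "x = right_lincomb n (map (col U) ?I) c"
    proof (rule eq_vecI)
      fix r assume "r < dim_vec (right_lincomb n (map (col U) ?I) c)"
      then have r: "r < n"
        using right_lincomb_carrier[OF car, of c] by simp
      have "x $ r = (\<Sum>i<n. U $$ (r, i) * y $ i)"
        using r facts(1) y by (simp add: scalar_prod_def lessThan_atLeast0)
      also have "\<dots> = (\<Sum>i\<in>set ?I. U $$ (r, i) * y $ i)"
        using class_eigenspace_coordinate_eq_0[OF x]
        by (intro sum.mono_neutral_right) (auto simp: y_def)
      also have "\<dots> = (\<Sum>k<length ?I. U $$ (r, ?I ! k) * c k)"
        unfolding c_def by (rule sum.reindex_bij_betw[OF bij, symmetric])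
      finally show "x $ r = right_lincomb n (map (col U) ?I) c $ r"
        by (simp only: lincomb[OF r])
    qed (use xc right_lincomb_carrier[OF car, of c] in simp)
    then show ?thesis
      by (intro exI[of _ c])
  qed
  moreover have "c l = 0" if c: "right_lincomb n (map (col U) ?I) c = 0\<^sub>v n" and l: "l < length ?I" for c l
  proof -
    have orth: "(\<Sum>r<n. conjugate (U $$ (r, ?I ! l)) * U $$ (r, ?I ! k)) = of_bool (k = l)"
      if k: "k < length ?I" for k
    proof -
      have "(\<Sum>r<n. conjugate (U $$ (r, ?I ! l)) * U $$ (r, ?I ! k)) = (conj_transpose U * U) $$ (?I ! l, ?I ! k)"
        using facts(1) Ik k l by (simp add: scalar_prod_def lessThan_atLeast0)
      also have "\<dots> = of_bool (k = l)"
        unfolding facts(3) using Ik k l nth_eq_iff_index_eq[of ?I l k] by auto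
      finally show ?thesis .
    qed
    \<comment> \<open>Pairing with column \<open>?I ! l\<close> isolates \<open>c l\<close>. The
      conjugated entries act from the left and leave the coefficients on the right
      untouched.\<close>
    have "0 = (\<Sum>r<n. conjugate (U $$ (r, ?I ! l)) * right_lincomb n (map (col U) ?I) c $ r)"
      unfolding c by simp
    also have "\<dots> = (\<Sum>r<n. \<Sum>k<length ?I. conjugate (U $$ (r, ?I ! l)) * U $$ (r, ?I ! k) * c k)"
      by (intro sum.cong) (auto simp: lincomb sum_distrib_left mult.assoc)
    also have "\<dots> = (\<Sum>k<length ?I. of_bool (k = l) * c k)"
      by (subst sum.swap) (simp add: orth flip: sum_distrib_right)
    also have "\<dots> = c l"
      using l by (subst sum.remove[of _ l]) auto
    finally show "c l = 0"
      by simp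
  qed
  ultimately show ?thesis
    unfolding right_basis_def by auto
qed

text \<open>The columns of the basis correspond to the counted indices. As the left-hand side
  involves neither \<open>U\<close> nor \<open>T\<close>, all Schur forms give the same
  count.\<close>

lemma geom_mult_eq_card_diagonal:
  "geom_mult q A = card {i. i < dim_row A \<and> T $$ (i, i) = class_rep q}"
proof -
  have "geom_mult q A = length (filter (\<lambda>i. T $$ (i, i) = class_rep q) [0..<n])"
    using A right_dim_eq_length[OF class_eigenspace_carrier schur_form_right_basis]
    by (simp add: geom_mult_def)
  also have "\<dots> = card {i. i < n \<and> T $$ (i, i) = class_rep q}"
    by (subst distinct_card[symmetric]) (auto intro!: arg_cong[of _ _ card])
  finally show ?thesis
    using A by simp
qed

end

theorem proposition2p6:
  fixes A :: "quat mat" and n :: nat and q :: quat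
  assumes "A \<in> carrier_mat n n"
    and "normal_mat A"
    and "right_eigenvalue A q"
  shows "alg_mult q A = geom_mult q A"
proof -
  obtain U where U: "unitary_mat n U" "upper_triangular (conj_transpose U * A * U)"
    "\<forall>i<n. (conj_transpose U * A * U) $$ (i, i) \<in> upper_complex"
    using ex_unitary_triangularization[OF assms(1)] by blast
  have "schur_form A U (conj_transpose U * A * U)"
    using U assms(1) by (auto simp: schur_form_def unitary_mat_def)
  \<comment> \<open>The Schur form just built provides existence for the definite description in
    \<open>alg_mult\<close>; uniqueness holds because the count for every Schur form equals
    \<open>geom_mult q A\<close>.\<close>
  then show ?thesis
    using geom_mult_eq_card_diagonal[OF assms(1,2)] unfolding alg_mult_def
    by (intro the_equality) (metis, metis)
qed

end
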